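(* Let $H$ be a finite-dimensional Hopf algebra over a field $\Bbbk$ and let $\lambda: H\to\Bbbk$ be a partial action. Then $H_\lambda$ is a Hopf subalgebra of $H$ if and only if $$\lambda(h_1)h_2=\lambda(h_1)h_2\lambda(h_3)$$ holds for all $h\in H$.
   Context: Sweedler notation $\Delta(h)=h_1\otimes h_2$, $(\Delta\otimes \mathrm{Id})\Delta(h)=h_1\otimes h_2\otimes h_3$ is used. A partial action of a Hopf algebra $H$ on its base field $\Bbbk$ is a linear map $\lambda: H\to\Bbbk$ such that $\lambda(1_H)=1_\Bbbk$ and $\lambda(h)\lambda(k)=\lambda(h_1)\lambda(h_2k)$ for all $h,k\in H$. For a partial action $\lambda$, one sets $H_\lambda=\{\lambda(h_1)h_2 \mid h\in H\}$, which is a subalgebra of $H$. *)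

theory Defs
  imports Complex_Main "HOL-Library.Poly_Mapping"
begin

text \<open>
  Tensor products over the base field. The \<open>k\<close>-vector space is a whole type \<open>'a\<close> with scalar
  multiplication \<open>scale\<close>; \<open>H \<otimes> H\<close> and \<open>H \<otimes> H \<otimes> H\<close> are the usual quotients of the free vector
  space on pairs (triples) by the subspace generated by the multilinearity relations. A
  ``slot'' is a map filling one tensor position and keeping the others fixed. Vectors of the
  quotient are cosets, i.e. classes of \<open>tensor_eq\<close>.
\<close>

definition free_scale :: "'k::field \<Rightarrow> ('i \<Rightarrow>\<^sub>0 'k) \<Rightarrow> ('i \<Rightarrow>\<^sub>0 'k)" where
  "free_scale c u = Poly_Mapping.map (\<lambda>d. c * d) u"

definition pair_slots :: "('a \<Rightarrow> 'a \<times> 'a) set" where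
  "pair_slots = {(\<lambda>x. (x, b)) | b. True} \<union> {(\<lambda>x. (a, x)) | a. True}"

definition triple_slots :: "('a \<Rightarrow> 'a \<times> 'a \<times> 'a) set" where
  "triple_slots = {(\<lambda>x. (x, b, c)) | b c. True} \<union> {(\<lambda>x. (a, x, c)) | a c. True}
     \<union> {(\<lambda>x. (a, b, x)) | a b. True}"

definition multilinear_relations ::
  "('k::field \<Rightarrow> 'a::ab_group_add \<Rightarrow> 'a) \<Rightarrow> ('a \<Rightarrow> 'i) set \<Rightarrow> ('i \<Rightarrow>\<^sub>0 'k) set" where
  "multilinear_relations scale slots =
     {Poly_Mapping.single (i (x + y)) 1 - Poly_Mapping.single (i x) 1
        - Poly_Mapping.single (i y) 1 | i x y. i \<in> slots}
     \<union> {Poly_Mapping.single (i (scale c x)) 1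
        - free_scale c (Poly_Mapping.single (i x) 1) | i c x. i \<in> slots}"

definition tensor_eq ::
  "('k::field \<Rightarrow> 'a::ab_group_add \<Rightarrow> 'a) \<Rightarrow> ('a \<Rightarrow> 'i) set \<Rightarrow> (('i \<Rightarrow>\<^sub>0 'k) \<times> ('i \<Rightarrow>\<^sub>0 'k)) set" where
  "tensor_eq scale slots =
     {(u, v). u - v \<in> module.span free_scale (multilinear_relations scale slots)}"

text \<open>The tensor \<open>\<Sum>\<^sub>i a\<^sub>i \<otimes> b\<^sub>i\<close> (resp. \<open>\<Sum>\<^sub>i a\<^sub>i \<otimes> b\<^sub>i \<otimes> c\<^sub>i\<close>) given by a list of pairs
  (resp. triples). Scalars can be absorbed into the factors, so these are all tensors, see
  \<open>tensor_pair_surj\<close>.\<close>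

definition tensor ::
  "('k::field \<Rightarrow> 'a::ab_group_add \<Rightarrow> 'a) \<Rightarrow> ('a \<Rightarrow> 'i) set \<Rightarrow> 'i list \<Rightarrow> ('i \<Rightarrow>\<^sub>0 'k) set" where
  "tensor scale slots ps =
     tensor_eq scale slots `` {\<Sum>p\<leftarrow>ps. Poly_Mapping.single p 1}"

abbreviation tensor2 where "tensor2 scale \<equiv> tensor scale pair_slots"
abbreviation tensor3 where "tensor3 scale \<equiv> tensor scale triple_slots"

text \<open>Sweedler notation: \<open>sweedler scale \<Delta> h\<close> is a list of pairs \<open>(h\<^sub>1, h\<^sub>2)\<close> with
  \<open>\<Delta> h = \<Sum> h\<^sub>1 \<otimes> h\<^sub>2\<close>. It is used only inside expressions that are multilinear in the factors,
  whose value does not depend on the chosen list, see \<open>tensor_sum_well_defined\<close>.\<close>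

definition sweedler ::
  "('k::field \<Rightarrow> 'a::ab_group_add \<Rightarrow> 'a) \<Rightarrow> ('a \<Rightarrow> ('a \<times> 'a \<Rightarrow>\<^sub>0 'k) set) \<Rightarrow> 'a \<Rightarrow> ('a \<times> 'a) list" where
  "sweedler scale comult h = (SOME ps. tensor2 scale ps = comult h)"

definition sweedler3 ::
  "('k::field \<Rightarrow> 'a::ab_group_add \<Rightarrow> 'a) \<Rightarrow> ('a \<Rightarrow> ('a \<times> 'a \<Rightarrow>\<^sub>0 'k) set) \<Rightarrow> 'a
    \<Rightarrow> ('a \<times> 'a \<times> 'a) list" where
  "sweedler3 scale comult h =
     [(h11, h12, h2). (h1, h2) \<leftarrow> sweedler scale comult h, (h11, h12) \<leftarrow> sweedler scale comult h1]"

text \<open>In \<open>comult_add\<close> and \<open>comult_scale\<close> the right-hand sides are the vector space operations of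
  the quotient \<open>H \<otimes> H\<close>, written on cosets.\<close>

locale hopf_algebra = vector_space scale
  for scale :: "'k::field \<Rightarrow> 'a::ring_1 \<Rightarrow> 'a" +
  fixes comult :: "'a \<Rightarrow> ('a \<times> 'a \<Rightarrow>\<^sub>0 'k) set"
    and counit :: "'a \<Rightarrow> 'k"
    and antipode :: "'a \<Rightarrow> 'a"
  assumes scale_mult_left: "scale c x * y = scale c (x * y)"
    and scale_mult_right: "x * scale c y = scale c (x * y)"
    and comult_tensor: "comult h \<in> UNIV // tensor_eq scale pair_slots"
    and comult_add: "comult (x + y) = {u + v | u v. u \<in> comult x \<and> v \<in> comult y}"
    and comult_scale: "comult (scale c x) = tensor_eq scale pair_slots `` (free_scale c ` comult x)"
    and coassoc:
      "tensor3 scale (sweedler3 scale comult h) =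
       tensor3 scale
         [(h1, h21, h22). (h1, h2) \<leftarrow> sweedler scale comult h,
                          (h21, h22) \<leftarrow> sweedler scale comult h2]"
    and counit_linear: "Vector_Spaces.linear scale (*) counit"
    and counit_left: "(\<Sum>(h1, h2)\<leftarrow>sweedler scale comult h. scale (counit h1) h2) = h"
    and counit_right: "(\<Sum>(h1, h2)\<leftarrow>sweedler scale comult h. scale (counit h2) h1) = h"
    and comult_one: "comult 1 = tensor2 scale [(1, 1)]"
    and comult_mult:
      "comult (x * y) =
       tensor2 scale
         [(x1 * y1, x2 * y2). (x1, x2) \<leftarrow> sweedler scale comult x,
                              (y1, y2) \<leftarrow> sweedler scale comult y]"
    and counit_one: "counit 1 = 1"
    and counit_mult: "counit (x * y) = counit x * counit y"
    and antipode_linear: "Vector_Spaces.linear scale scale antipode"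
    and antipode_left:
      "(\<Sum>(h1, h2)\<leftarrow>sweedler scale comult h. antipode h1 * h2) = scale (counit h) 1"
    and antipode_right:
      "(\<Sum>(h1, h2)\<leftarrow>sweedler scale comult h. h1 * antipode h2) = scale (counit h) 1"

definition hopf_subalgebra ::
  "('k::field \<Rightarrow> 'a::ring_1 \<Rightarrow> 'a) \<Rightarrow> ('a \<Rightarrow> ('a \<times> 'a \<Rightarrow>\<^sub>0 'k) set) \<Rightarrow> ('a \<Rightarrow> 'a)
    \<Rightarrow> 'a set \<Rightarrow> bool" where
  "hopf_subalgebra scale comult antipode A \<longleftrightarrow>
     module.subspace scale A
     \<and> 1 \<in> A \<and> (\<forall>x\<in>A. \<forall>y\<in>A. x * y \<in> A)
     \<and> comult ` A \<subseteq> {tensor2 scale ps | ps. set ps \<subseteq> A \<times> A}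
     \<and> antipode ` A \<subseteq> A"

definition partial_action ::
  "('k::field \<Rightarrow> 'a::ring_1 \<Rightarrow> 'a) \<Rightarrow> ('a \<Rightarrow> ('a \<times> 'a \<Rightarrow>\<^sub>0 'k) set) \<Rightarrow> ('a \<Rightarrow> 'k) \<Rightarrow> bool" where
  "partial_action scale comult lam \<longleftrightarrow>
     Vector_Spaces.linear scale (*) lam
     \<and> lam 1 = 1
     \<and> (\<forall>h k. lam h * lam k = (\<Sum>(h1, h2)\<leftarrow>sweedler scale comult h. lam h1 * lam (h2 * k)))"

definition H_lam ::
  "('k::field \<Rightarrow> 'a::ring_1 \<Rightarrow> 'a) \<Rightarrow> ('a \<Rightarrow> ('a \<times> 'a \<Rightarrow>\<^sub>0 'k) set) \<Rightarrow> ('a \<Rightarrow> 'k) \<Rightarrow> 'a set" where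
  "H_lam scale comult lam =
     {\<Sum>(h1, h2)\<leftarrow>sweedler scale comult h. scale (lam h1) h2 | h. True}"

lemma lookup_free_scale: "Poly_Mapping.lookup (free_scale c u) i = c * Poly_Mapping.lookup u i"
  unfolding free_scale_def by transfer (auto simp: when_def)

lemma vector_space_free_scale: "vector_space (free_scale :: 'k::field \<Rightarrow> ('i \<Rightarrow>\<^sub>0 'k) \<Rightarrow> _)"
  by unfold_locales
    (auto intro!: poly_mapping_eqI simp: lookup_free_scale lookup_add algebra_simps)

lemma free_scale_single:
  "free_scale c (Poly_Mapping.single i d) = Poly_Mapping.single i (c * d)"
  by (auto intro!: poly_mapping_eqI simp: lookup_free_scale lookup_single when_def)

interpretation free: vector_space "free_scale :: 'k::field \<Rightarrow> ('i \<Rightarrow>\<^sub>0 'k) \<Rightarrow> _"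
  by (rule vector_space_free_scale)

lemma equiv_tensor_eq: "equiv UNIV (tensor_eq scale slots)"
proof (rule equivI)
  show "refl (tensor_eq scale slots)"
    by (auto simp: refl_on_def tensor_eq_def free.span_zero)
  show "sym (tensor_eq scale slots)"
  proof (rule symI)
    fix u v assume "(u, v) \<in> tensor_eq scale slots"
    then show "(v, u) \<in> tensor_eq scale slots"
      using free.span_neg[of "u - v"] by (simp add: tensor_eq_def)
  qed
  show "trans (tensor_eq scale slots)"
  proof (rule transI)
    fix u v w assume "(u, v) \<in> tensor_eq scale slots" "(v, w) \<in> tensor_eq scale slots"
    then show "(u, w) \<in> tensor_eq scale slots"
      using free.span_add[of "u - v" _ "v - w"] by (simp add: tensor_eq_def)
  qed
qed auto

lemma tensor_pair_surj:
  assumes "T \<in> UNIV // tensor_eq scale (pair_slots :: ('a::ab_group_add \<Rightarrow> _) set)"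
  shows "\<exists>ps. T = tensor2 scale ps"
proof -
  let ?e = "tensor_eq scale (pair_slots :: ('a \<Rightarrow> _) set)"
  let ?F = "\<lambda>ps. \<Sum>p\<leftarrow>ps. Poly_Mapping.single p 1"
  have single: "\<exists>ps. (Poly_Mapping.single p c, ?F ps) \<in> ?e" for p c
  proof -
    obtain a b where p: "p = (a, b)" by force
    have "Poly_Mapping.single (scale c a, b) 1 - free_scale c (Poly_Mapping.single (a, b) 1)
        \<in> multilinear_relations scale pair_slots"
      unfolding multilinear_relations_def pair_slots_def
      by (intro UnI2 CollectI exI[of _ "\<lambda>x. (x, b)"] exI[of _ c] exI[of _ a]) auto
    then have "(Poly_Mapping.single (scale c a, b) 1, Poly_Mapping.single p c) \<in> ?e"
      unfolding tensor_eq_def p using free.span_base by (fastforce simp: free_scale_single)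
    then have "(Poly_Mapping.single p c, ?F [(scale c a, b)]) \<in> ?e"
      using equiv_tensor_eq[of scale pair_slots] by (auto simp: equiv_def dest: symD)
    then show ?thesis by blast
  qed
  have "\<exists>ps. (u, ?F ps) \<in> ?e" for u
  proof (induction u rule: update_induct)
    case const
    have "(0, ?F []) \<in> ?e" by (simp add: tensor_eq_def free.span_zero)
    then show ?case by blast
  next
    case (update u p c)
    then obtain ps where ps: "(u, ?F ps) \<in> ?e" by blast
    obtain qs where qs: "(Poly_Mapping.single p c, ?F qs) \<in> ?e" using single by blast
    have "Poly_Mapping.update p c u = u + Poly_Mapping.single p c"
      using update.hyps(1)
      by (auto intro!: poly_mapping_eqI
        simp: lookup_update lookup_add lookup_single when_def in_keys_iff)
    then have "(Poly_Mapping.update p c u, ?F (ps @ qs)) \<in> ?e"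
      using free.span_add[of "u - ?F ps" _ "Poly_Mapping.single p c - ?F qs"] ps qs
      by (simp add: tensor_eq_def algebra_simps)
    then show ?case by blast
  qed
  moreover obtain u where "T = ?e `` {u}" using assms by (auto elim: quotientE)
  ultimately show ?thesis
    unfolding tensor_def using equiv_class_eq[OF equiv_tensor_eq] by metis
qed

lemma tensor_sum_well_defined:
  fixes f :: "'i \<Rightarrow> 'c::ab_group_add"
  assumes lin: "\<And>i. i \<in> slots \<Longrightarrow> Vector_Spaces.linear scale s (\<lambda>x. f (i x))"
    and s: "vector_space s"
    and eq: "tensor scale slots ps = tensor scale slots qs"
  shows "(\<Sum>p\<leftarrow>ps. f p) = (\<Sum>p\<leftarrow>qs. f p)"
proof -
  interpret s: vector_space s by (rule s)
  define L where "L u = (\<Sum>p\<in>Poly_Mapping.keys u. s (Poly_Mapping.lookup u p) (f p))" for u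
  have L_sup: "L u = (\<Sum>p\<in>A. s (Poly_Mapping.lookup u p) (f p))"
    if "finite A" "Poly_Mapping.keys u \<subseteq> A" for A u
    unfolding L_def by (rule sum.mono_neutral_left) (use that in \<open>auto simp: in_keys_iff\<close>)
  have add: "L (u + v) = L u + L v" for u v
  proof -
    let ?A = "Poly_Mapping.keys u \<union> Poly_Mapping.keys v"
    have "L (u + v) = (\<Sum>p\<in>?A. s (Poly_Mapping.lookup (u + v) p) (f p))"
      by (rule L_sup) (auto dest: subsetD[OF keys_add])
    then show ?thesis
      by (simp add: L_sup[of ?A] lookup_add s.scale_left_distrib sum.distrib)
  qed
  have sc: "L (free_scale c u) = s c (L u)" for c u
  proof -
    have "L (free_scale c u) =
        (\<Sum>p\<in>Poly_Mapping.keys u. s (Poly_Mapping.lookup (free_scale c u) p) (f p))"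
      by (rule L_sup) (auto simp: in_keys_iff lookup_free_scale)
    then show ?thesis by (simp add: L_def lookup_free_scale s.scale_sum_right)
  qed
  have sng: "L (Poly_Mapping.single p 1) = f p" for p
    by (simp add: L_def)
  have diff: "L (u - v) = L u - L v" for u v
    using add[of "u - v" v] by (simp add: algebra_simps)
  have zero: "L 0 = 0" by (simp add: L_def)
  have F: "L (\<Sum>p\<leftarrow>xs. Poly_Mapping.single p 1) = (\<Sum>p\<leftarrow>xs. f p)" for xs
    by (induction xs) (simp_all add: zero add sng)
  have rel: "L r = 0" if r: "r \<in> multilinear_relations scale slots" for r
  proof -
    have "f (i (x + y)) = f (i x) + f (i y)" "f (i (scale c x)) = s c (f (i x))"
      if "i \<in> slots" for i x y c
    proof -
      interpret l: Vector_Spaces.linear scale s "\<lambda>x. f (i x)" by (rule lin[OF that])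
      show "f (i (x + y)) = f (i x) + f (i y)" by (rule l.add)
      show "f (i (scale c x)) = s c (f (i x))" by (rule l.scale)
    qed
    then show ?thesis
      using r unfolding multilinear_relations_def by (auto simp: diff sng sc)
  qed
  have span: "L r = 0" if "r \<in> free.span (multilinear_relations scale slots)" for r
    using that by (induction rule: free.span_induct_alt) (simp_all add: zero add sc rel)
  have "((\<Sum>p\<leftarrow>ps. Poly_Mapping.single p 1), (\<Sum>p\<leftarrow>qs. Poly_Mapping.single p 1))
      \<in> tensor_eq scale slots"
    using eq unfolding tensor_def
    by (simp add: eq_equiv_class_iff[OF equiv_tensor_eq])
  then have "L ((\<Sum>p\<leftarrow>ps. Poly_Mapping.single p 1) - (\<Sum>p\<leftarrow>qs. Poly_Mapping.single p 1)) = 0"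
    by (simp add: tensor_eq_def span)
  then show ?thesis by (simp add: diff F)
qed

end

theory Submission
  imports Defs
begin

text \<open>
  Write \<open>E h = \<lambda>(h\<^sub>1) h\<^sub>2\<close>, so that \<open>H\<^sub>\<lambda>\<close> is the range of the linear map \<open>E\<close>. The argument rests on
  five elementary identities. Coassociativity gives \<open>\<Delta>(E h) = E h\<^sub>1 \<otimes> h\<^sub>2\<close> (\<open>comult_sum_E\<close>). The
  partial action axiom with \<open>k = 1\<close> gives \<open>\<lambda>(E h) = \<lambda>(h)\<close>, and in general it reads
  \<open>\<lambda>(E h \<cdot> k) = \<lambda>(h) \<lambda>(k)\<close>, from which \<open>E(E h \<cdot> k) = E h \<cdot> E k\<close> follows. Finally
  \<open>\<epsilon>(E h) = \<lambda>(h)\<close> by the counit axiom. In particular \<open>\<lambda>\<close> and \<open>\<epsilon>\<close> agree on \<open>H\<^sub>\<lambda>\<close>.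

  Contracting the second factor of \<open>\<Delta>(E h) = E h\<^sub>1 \<otimes> h\<^sub>2\<close> with \<open>\<lambda>\<close> shows that the right-hand side
  \<open>\<lambda>(h\<^sub>1) h\<^sub>2 \<lambda>(h\<^sub>3)\<close> of the condition is \<open>a\<^sub>1 \<lambda>(a\<^sub>2)\<close> for \<open>a = E h\<close>. So the condition says that
  \<open>a = a\<^sub>1 \<lambda>(a\<^sub>2)\<close> for all \<open>a \<in> H\<^sub>\<lambda>\<close>. If \<open>H\<^sub>\<lambda>\<close> is a Hopf subalgebra, then \<open>a\<^sub>2\<close> can be taken in \<open>H\<^sub>\<lambda>\<close>,
  where \<open>\<lambda> = \<epsilon>\<close>, and the condition becomes the counit axiom.

  Conversely, under the condition the factor \<open>E h\<^sub>1\<close> in \<open>\<Delta>(E h)\<close> absorbs a further \<open>\<lambda>\<close>, which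
  coassociativity passes on to the second factor: \<open>\<Delta>(E h) = E h\<^sub>1 \<otimes> E h\<^sub>2\<close>
  (\<open>comult_sum_E_E\<close>), so \<open>H\<^sub>\<lambda>\<close> is a subcoalgebra. By \<open>E(a k) = a E(k)\<close> for \<open>a \<in> H\<^sub>\<lambda>\<close>, the map
  \<open>E \<circ> S\<close> is, like the antipode \<open>S\<close>, a right convolution inverse of the inclusion of \<open>H\<^sub>\<lambda>\<close>. As
  convolution inverses are unique, \<open>S a = E(S a)\<close>, which lies in \<open>H\<^sub>\<lambda>\<close> (\<open>antipode_E\<close>).

  A tensor is handled through its images under multilinear maps. These images determine it
  (\<open>tensor_eqI\<close>), so every identity between tensors becomes an identity between sums.
\<close>

section \<open>Multilinear maps separate tensors\<close>

lemma (in vector_space) exists_linear_with_kernel_span: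
  "\<exists>P. Vector_Spaces.linear scale scale P \<and> (\<forall>u. P u = 0 \<longleftrightarrow> u \<in> span R)"
proof -
  interpret pair: vector_space_pair scale scale by unfold_locales
  obtain B where B: "B \<subseteq> R" "independent B" "R \<subseteq> span B"
    using maximal_independent_subset by blast
  then have span_B: "span B = span R"
    by (metis span_mono span_span subset_antisym)
  \<comment> \<open>\<open>P\<close> is the projection along \<open>span R\<close> onto the complement spanned by the remaining basis.\<close>
  define C where "C = extend_basis B"
  have C: "B \<subseteq> C" "independent C" "span C = UNIV"
    unfolding C_def using extend_basis_superset independent_extend_basis span_extend_basis B(2)
    by auto
  obtain P where P: "Vector_Spaces.linear scale scale P"
    and P_basis: "\<forall>x\<in>C. P x = (if x \<in> B then 0 else x)"
    using pair.linear_independent_extend[OF C(2), of "\<lambda>x. if x \<in> B then 0 else x"] by blast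
  interpret P: Vector_Spaces.linear scale scale P by (rule P)
  have P_B: "P v = 0" if "v \<in> span B" for v
    using that P_basis C(1)
    by (induction rule: span_induct_alt) (auto simp: P.zero P.add P.scale)
  have P_C: "P w = w" if "w \<in> span (C - B)" for w
    using that P_basis
    by (induction rule: span_induct_alt) (auto simp: P.zero P.add P.scale)
  have "P u = 0 \<longleftrightarrow> u \<in> span B" for u
  proof -
    have "u \<in> span (B \<union> (C - B))" using C by (simp add: Un_absorb1)
    then obtain v w where "u = v + w" "v \<in> span B" "w \<in> span (C - B)"
      unfolding span_Un by blast
    then show ?thesis using P_B P_C P_B[of u] by (auto simp: P.add)
  qed
  then show ?thesis using P span_B by metis
qed

text \<open>The space of tensors is not a type, so there is no universal multilinear map to test with.
  A linear endomorphism \<open>P\<close> of the free vector space that kills exactly the span of the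
  multilinearity relations takes its place: \<open>p \<mapsto> P(p)\<close> is multilinear, and its values on two
  lists have the same sum only if the lists represent the same tensor. Hence a single target
  space suffices for the test maps.\<close>

lemma tensor_eqI:
  fixes scale :: "'k::field \<Rightarrow> 'a::ab_group_add \<Rightarrow> 'a" and slots :: "('a \<Rightarrow> 'i) set"
  assumes "vector_space scale"
    and eq: "\<And>f :: 'i \<Rightarrow> ('i \<Rightarrow>\<^sub>0 'k).
      (\<And>i. i \<in> slots \<Longrightarrow> Vector_Spaces.linear scale free_scale (\<lambda>x. f (i x))) \<Longrightarrow>
      (\<Sum>p\<leftarrow>ps. f p) = (\<Sum>p\<leftarrow>qs. f p)"
  shows "tensor scale slots ps = tensor scale slots qs"
proof -
  let ?R = "multilinear_relations scale slots"
  obtain P :: "('i \<Rightarrow>\<^sub>0 'k) \<Rightarrow> ('i \<Rightarrow>\<^sub>0 'k)" where P: "Vector_Spaces.linear free_scale free_scale P"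
    and "\<forall>u. P u = 0 \<longleftrightarrow> u \<in> free.span ?R"
    using free.exists_linear_with_kernel_span[of ?R] by blast
  then have kernel: "P u = 0 \<longleftrightarrow> u \<in> free.span ?R" for u by blast
  interpret P: Vector_Spaces.linear free_scale free_scale P by (rule P)
  let ?f = "\<lambda>p. P (Poly_Mapping.single p 1)"
  have "Vector_Spaces.linear scale free_scale (\<lambda>x. ?f (i x))" if i: "i \<in> slots" for i
  proof -
    have "P (Poly_Mapping.single (i (x + y)) 1 - Poly_Mapping.single (i x) 1
        - Poly_Mapping.single (i y) 1) = 0" for x y
      unfolding kernel using i by (intro free.span_base) (auto simp: multilinear_relations_def)
    moreover have "P (Poly_Mapping.single (i (scale c x)) 1
        - free_scale c (Poly_Mapping.single (i x) 1)) = 0" for c x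
      unfolding kernel using i by (intro free.span_base) (unfold multilinear_relations_def, blast)
    ultimately show ?thesis
      using \<open>vector_space scale\<close> vector_space_free_scale
      by (simp add: Vector_Spaces.linear_iff P.diff P.add P.scale diff_diff_eq)
  qed
  then have "(\<Sum>p\<leftarrow>ps. ?f p) = (\<Sum>p\<leftarrow>qs. ?f p)" by (rule eq)
  moreover have "(\<Sum>p\<leftarrow>xs. ?f p) = P (\<Sum>p\<leftarrow>xs. Poly_Mapping.single p 1)" for xs
    by (induction xs) (simp_all add: P.zero P.add)
  ultimately have "P ((\<Sum>p\<leftarrow>ps. Poly_Mapping.single p 1) - (\<Sum>p\<leftarrow>qs. Poly_Mapping.single p 1)) = 0"
    by (simp add: P.diff)
  then show ?thesis
    unfolding tensor_def kernel
    by (intro equiv_class_eq[OF equiv_tensor_eq]) (simp add: tensor_eq_def)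
qed

section \<open>Calculus of Sweedler sums\<close>

context hopf_algebra
begin

definition bilinear :: "('k \<Rightarrow> 'c::ab_group_add \<Rightarrow> 'c) \<Rightarrow> ('a \<Rightarrow> 'a \<Rightarrow> 'c) \<Rightarrow> bool" where
  "bilinear s f \<longleftrightarrow> (\<forall>y. Vector_Spaces.linear scale s (\<lambda>x. f x y))
     \<and> (\<forall>x. Vector_Spaces.linear scale s (f x))"

definition trilinear :: "('k \<Rightarrow> 'c::ab_group_add \<Rightarrow> 'c) \<Rightarrow> ('a \<Rightarrow> 'a \<Rightarrow> 'a \<Rightarrow> 'c) \<Rightarrow> bool" where
  "trilinear s f \<longleftrightarrow> (\<forall>y z. Vector_Spaces.linear scale s (\<lambda>x. f x y z))
     \<and> (\<forall>x z. Vector_Spaces.linear scale s (\<lambda>y. f x y z))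
     \<and> (\<forall>x y. Vector_Spaces.linear scale s (f x y))"

text \<open>For bilinear \<open>f\<close> this is \<open>f\<close>, as a linear map on \<open>H \<otimes> H\<close>, composed with the
  comultiplication.\<close>

definition comult_sum :: "('a \<Rightarrow> 'a \<Rightarrow> 'c::comm_monoid_add) \<Rightarrow> 'a \<Rightarrow> 'c" where
  "comult_sum f h = (\<Sum>(x, y)\<leftarrow>sweedler scale comult h. f x y)"

lemma linearI:
  assumes "vector_space s" "\<And>x y. f (x + y) = f x + f y" "\<And>c x. f (scale c x) = s c (f x)"
  shows "Vector_Spaces.linear scale s f"
  using assms vector_space_axioms by (simp add: Vector_Spaces.linear_iff)

lemma vector_space_field: "vector_space ((*) :: 'k \<Rightarrow> 'k \<Rightarrow> 'k)"
  by unfold_locales (simp_all add: algebra_simps)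

lemma tensor2_sweedler: "tensor2 scale (sweedler scale comult h) = comult h"
  unfolding sweedler_def using tensor_pair_surj[OF comult_tensor, of h] by (metis (mono_tags) someI)

lemma bilinear_tensor2_cong:
  assumes "bilinear s f" "tensor2 scale ps = tensor2 scale qs"
  shows "(\<Sum>(x, y)\<leftarrow>ps. f x y) = (\<Sum>(x, y)\<leftarrow>qs. f x y)"
proof (rule tensor_sum_well_defined[OF _ _ assms(2), where s = s])
  show "vector_space s"
    using assms(1) by (auto simp: bilinear_def Vector_Spaces.linear_iff)
  show "Vector_Spaces.linear scale s (\<lambda>x. case i x of (x, y) \<Rightarrow> f x y)" if "i \<in> pair_slots" for i
    using that assms(1) by (auto simp: pair_slots_def bilinear_def)
qed

text \<open>Sweedler sums may be computed from any representation of the coproduct, not only from the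
  chosen one.\<close>

lemma comult_sum_eqI:
  assumes "bilinear s f" "comult h = tensor2 scale ps"
  shows "comult_sum f h = (\<Sum>(x, y)\<leftarrow>ps. f x y)"
  unfolding comult_sum_def
  by (rule bilinear_tensor2_cong[OF assms(1)]) (simp add: tensor2_sweedler assms(2))

lemma comult_eqI:
  assumes "\<And>f :: 'a \<Rightarrow> 'a \<Rightarrow> ('a \<times> 'a \<Rightarrow>\<^sub>0 'k).
    bilinear free_scale f \<Longrightarrow> comult_sum f h = (\<Sum>(x, y)\<leftarrow>ps. f x y)"
  shows "comult h = tensor2 scale ps"
proof -
  have "tensor2 scale (sweedler scale comult h) = tensor2 scale ps"
  proof (rule tensor_eqI[OF vector_space_axioms])
    fix f :: "'a \<times> 'a \<Rightarrow> ('a \<times> 'a \<Rightarrow>\<^sub>0 'k)"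
    assume f: "\<And>i. i \<in> pair_slots \<Longrightarrow> Vector_Spaces.linear scale free_scale (\<lambda>x. f (i x))"
    have "bilinear free_scale (\<lambda>x y. f (x, y))"
      unfolding bilinear_def using f by (auto simp: pair_slots_def)
    from assms[OF this] show "(\<Sum>p\<leftarrow>sweedler scale comult h. f p) = (\<Sum>p\<leftarrow>ps. f p)"
      by (simp add: comult_sum_def)
  qed
  then show ?thesis by (simp add: tensor2_sweedler)
qed

lemma comult_eq_class:
  assumes "u \<in> comult h"
  shows "comult h = tensor_eq scale pair_slots `` {u}"
  using assms comult_tensor[of h] equiv_class_eq[OF equiv_tensor_eq[of scale pair_slots]]
  by (auto elim!: quotientE)

lemma sweedler_in_comult: "(\<Sum>p\<leftarrow>sweedler scale comult h. Poly_Mapping.single p 1) \<in> comult h"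
  unfolding tensor2_sweedler[of h, symmetric] tensor_def
  by (simp add: tensor_eq_def free.span_zero)

text \<open>In \<open>comult_add\<close> the sum of two cosets is formed elementwise. The sum of the two chosen
  representatives is one of its elements, and an element determines its coset.\<close>

lemma comult_add_sweedler:
  "comult (x + y) = tensor2 scale (sweedler scale comult x @ sweedler scale comult y)"
proof -
  have "(\<Sum>p\<leftarrow>sweedler scale comult x @ sweedler scale comult y. Poly_Mapping.single p 1)
      \<in> comult (x + y)"
    unfolding comult_add using sweedler_in_comult by force
  then show ?thesis unfolding tensor_def by (rule comult_eq_class)
qed

lemma free_scale_tensor_eq:
  "(free_scale c (\<Sum>p\<leftarrow>ps. Poly_Mapping.single p 1),
    \<Sum>p\<leftarrow>map (\<lambda>(x, y). (scale c x, y)) ps. Poly_Mapping.single p 1) \<in> tensor_eq scale pair_slots"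
proof (induction ps)
  case Nil
  then show ?case by (simp add: tensor_eq_def free.span_zero)
next
  case (Cons p ps)
  obtain a b where p: "p = (a, b)" by force
  have "Poly_Mapping.single (scale c a, b) 1 - free_scale c (Poly_Mapping.single (a, b) 1)
      \<in> multilinear_relations scale pair_slots"
    unfolding multilinear_relations_def pair_slots_def
    by (intro UnI2 CollectI exI[of _ "\<lambda>x. (x, b)"] exI[of _ c] exI[of _ a]) auto
  then have "free_scale c (Poly_Mapping.single (a, b) 1) - Poly_Mapping.single (scale c a, b) 1
      \<in> free.span (multilinear_relations scale pair_slots)"
    using free.span_neg[OF free.span_base] by fastforce
  from free.span_add[OF this] Cons show ?case
    by (fastforce simp: tensor_eq_def p free.scale_right_distrib algebra_simps)
qed

lemma comult_scale_sweedler: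
  "comult (scale c x) = tensor2 scale (map (\<lambda>(x, y). (scale c x, y)) (sweedler scale comult x))"
proof -
  have "(\<Sum>p\<leftarrow>map (\<lambda>(x, y). (scale c x, y)) (sweedler scale comult x). Poly_Mapping.single p 1)
      \<in> comult (scale c x)"
    unfolding comult_scale using sweedler_in_comult free_scale_tensor_eq by blast
  then show ?thesis unfolding tensor_def by (rule comult_eq_class)
qed

lemma linear_comult_sum:
  assumes "bilinear s f"
  shows "Vector_Spaces.linear scale s (comult_sum f)"
proof (rule linearI)
  show s: "vector_space s" using assms by (auto simp: bilinear_def Vector_Spaces.linear_iff)
  interpret s: vector_space s by (rule s)
  show "comult_sum f (x + y) = comult_sum f x + comult_sum f y" for x y
    unfolding comult_sum_eqI[OF assms comult_add_sweedler] by (simp add: comult_sum_def)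
  have "f (scale c x) y = s c (f x y)" for c x y
    using assms by (auto simp: bilinear_def Vector_Spaces.linear_iff)
  then have "(\<Sum>(x, y)\<leftarrow>map (\<lambda>(x, y). (scale c x, y)) ps. f x y) = s c (\<Sum>(x, y)\<leftarrow>ps. f x y)"
    for c ps by (induction ps) (auto simp: s.scale_right_distrib)
  then show "comult_sum f (scale c x) = s c (comult_sum f x)" for c x
    unfolding comult_sum_eqI[OF assms comult_scale_sweedler] by (simp add: comult_sum_def)
qed

lemma comult_sum_linear:
  assumes "Vector_Spaces.linear s t g"
  shows "g (comult_sum f h) = comult_sum (\<lambda>x y. g (f x y)) h"
proof -
  interpret g: Vector_Spaces.linear s t g by (rule assms)
  have "g (\<Sum>(x, y)\<leftarrow>ps. f x y) = (\<Sum>(x, y)\<leftarrow>ps. g (f x y))" for ps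
    by (induction ps) (auto simp: g.zero g.add)
  then show ?thesis by (simp add: comult_sum_def)
qed

text \<open>Linearity in a parameter of the summand. It yields the bilinearity of nested Sweedler
  sums.\<close>

lemma linear_comult_sum_param:
  assumes s: "vector_space s" and f: "\<And>x y. Vector_Spaces.linear scale s (\<lambda>z. f z x y)"
  shows "Vector_Spaces.linear scale s (\<lambda>z. comult_sum (f z) h)"
proof (rule linearI[OF s])
  interpret s: vector_space s by (rule s)
  have eqs: "f (z + z') x y = f z x y + f z' x y" "f (scale c z) x y = s c (f z x y)" for c z z' x y
    using f by (auto simp: Vector_Spaces.linear_iff)
  have "(\<Sum>(x, y)\<leftarrow>ps. f (z + z') x y) = (\<Sum>(x, y)\<leftarrow>ps. f z x y) + (\<Sum>(x, y)\<leftarrow>ps. f z' x y)"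
    for ps z z' by (induction ps) (auto simp: eqs ac_simps)
  then show "comult_sum (f (z + z')) h = comult_sum (f z) h + comult_sum (f z') h" for z z'
    by (simp add: comult_sum_def)
  have "(\<Sum>(x, y)\<leftarrow>ps. f (scale c z) x y) = s c (\<Sum>(x, y)\<leftarrow>ps. f z x y)"
    for ps c z by (induction ps) (auto simp: eqs s.scale_right_distrib)
  then show "comult_sum (f (scale c z)) h = s c (comult_sum (f z) h)" for c z
    by (simp add: comult_sum_def)
qed

lemma sum_list_concat_pairs:
  "(\<Sum>(x, y, z)\<leftarrow>concat (map (\<lambda>(x, y). map (\<lambda>(u, v). g x y u v) (xs x y)) ps). f x y z)
    = (\<Sum>(x, y)\<leftarrow>ps. \<Sum>(u, v)\<leftarrow>xs x y. case g x y u v of (x, y, z) \<Rightarrow> f x y z)"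
  by (induction ps) (auto simp: o_def case_prod_beta)

lemma sum_sweedler3:
  "(\<Sum>(x, y, z)\<leftarrow>sweedler3 scale comult h. f x y z)
    = comult_sum (\<lambda>w z. comult_sum (\<lambda>x y. f x y z) w) h"
  unfolding sweedler3_def comult_sum_def sum_list_concat_pairs by simp

lemma comult_sum_coassoc:
  assumes "trilinear s f"
  shows "comult_sum (\<lambda>w z. comult_sum (\<lambda>x y. f x y z) w) h
    = comult_sum (\<lambda>x w. comult_sum (f x) w) h"
proof -
  have "(\<Sum>p\<leftarrow>sweedler3 scale comult h. case p of (x, y, z) \<Rightarrow> f x y z)
    = (\<Sum>p\<leftarrow>[(h1, h21, h22). (h1, h2) \<leftarrow> sweedler scale comult h,
              (h21, h22) \<leftarrow> sweedler scale comult h2]. case p of (x, y, z) \<Rightarrow> f x y z)"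
  proof (rule tensor_sum_well_defined[OF _ _ coassoc, where s = s])
    show "vector_space s"
      using assms by (auto simp: trilinear_def Vector_Spaces.linear_iff)
    show "Vector_Spaces.linear scale s (\<lambda>x. case i x of (x, y, z) \<Rightarrow> f x y z)"
      if "i \<in> triple_slots" for i
      using that assms by (auto simp: triple_slots_def trilinear_def)
  qed
  then show ?thesis
    unfolding sum_sweedler3 sum_list_concat_pairs by (simp add: comult_sum_def)
qed

lemma comult_sum_mult:
  assumes "bilinear s f"
  shows "comult_sum f (x * y)
    = comult_sum (\<lambda>x1 x2. comult_sum (\<lambda>y1 y2. f (x1 * y1) (x2 * y2)) y) x"
proof -
  have "(\<Sum>(x, y)\<leftarrow>concat (map (\<lambda>(x, y). map (\<lambda>(u, v). (x * u, y * v)) xs) ps). f x y)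
    = (\<Sum>(x, y)\<leftarrow>ps. \<Sum>(u, v)\<leftarrow>xs. f (x * u) (y * v))" for ps xs
    by (induction ps) (auto simp: o_def case_prod_beta)
  then show ?thesis
    unfolding comult_sum_eqI[OF assms comult_mult] by (simp add: comult_sum_def)
qed

end

section \<open>The projection onto the range of a partial action\<close>

locale partial_action_on_field = hopf_algebra scale comult counit antipode
  for scale :: "'k::field \<Rightarrow> 'a::ring_1 \<Rightarrow> 'a"
    and comult :: "'a \<Rightarrow> ('a \<times> 'a \<Rightarrow>\<^sub>0 'k) set"
    and counit :: "'a \<Rightarrow> 'k"
    and antipode :: "'a \<Rightarrow> 'a" +
  fixes lam :: "'a \<Rightarrow> 'k"
  assumes partial_action: "partial_action scale comult lam"
begin

definition E :: "'a \<Rightarrow> 'a" where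
  "E = comult_sum (\<lambda>x y. scale (lam x) y)"

lemma linear_lam: "Vector_Spaces.linear scale (*) lam"
  using partial_action unfolding partial_action_def by blast

lemma lam_one: "lam 1 = 1"
  using partial_action unfolding partial_action_def by blast

lemma lam_mult: "lam h * lam k = comult_sum (\<lambda>x y. lam x * lam (y * k)) h"
  using partial_action unfolding partial_action_def comult_sum_def by blast

lemma linear_simps:
  "lam (x + y) = lam x + lam y" "lam (scale c x) = c * lam x"
  "counit (x + y) = counit x + counit y" "counit (scale c x) = c * counit x"
  "antipode (x + y) = antipode x + antipode y" "antipode (scale c x) = scale c (antipode x)"
  using linear_lam counit_linear antipode_linear by (simp_all add: Vector_Spaces.linear_iff)

lemma bilinear_E: "bilinear scale (\<lambda>x y. scale (lam x) y)"
  unfolding bilinear_def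
  by (auto intro!: linearI vector_space_axioms simp: linear_simps scale_left_distrib scale_right_distrib mult.commute)

lemma linear_E: "Vector_Spaces.linear scale scale E"
  unfolding E_def by (rule linear_comult_sum[OF bilinear_E])

text \<open>This is \<open>\<Delta>(E h) = E h\<^sub>1 \<otimes> h\<^sub>2\<close>, read through a bilinear map: both sides are
  \<open>\<lambda>(h\<^sub>1) f(h\<^sub>2, h\<^sub>3)\<close>, bracketed differently.\<close>

lemma comult_sum_E:
  assumes f: "bilinear s f"
  shows "comult_sum f (E h) = comult_sum (\<lambda>x y. f (E x) y) h"
proof -
  have lin: "Vector_Spaces.linear scale s (comult_sum f)" by (rule linear_comult_sum[OF f])
  have s: "vector_space s" using lin by (simp add: Vector_Spaces.linear_iff)
  interpret s: vector_space s by (rule s)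
  have f1: "Vector_Spaces.linear scale s (\<lambda>x. f x y)" for y
    using f by (simp add: bilinear_def)
  have f2: "Vector_Spaces.linear scale s (f x)" for x
    using f by (simp add: bilinear_def)
  note fs = Vector_Spaces.linear_iff[THEN iffD1, OF f1] Vector_Spaces.linear_iff[THEN iffD1, OF f2]
  have sc: "Vector_Spaces.linear s s (s c)" for c
    using s by (simp add: Vector_Spaces.linear_iff s.scale_right_distrib mult.commute)
  have tri: "trilinear s (\<lambda>x y z. s (lam x) (f y z))"
    unfolding trilinear_def
    by (auto intro!: linearI s simp: linear_simps fs s.scale_left_distrib s.scale_right_distrib mult.commute)
  have "comult_sum f (E h) = comult_sum (\<lambda>x w. comult_sum f (scale (lam x) w)) h"
    unfolding E_def by (rule comult_sum_linear[OF lin])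
  also have "\<dots> = comult_sum (\<lambda>x w. s (lam x) (comult_sum f w)) h"
    using lin by (simp add: Vector_Spaces.linear_iff)
  also have "\<dots> = comult_sum (\<lambda>x w. comult_sum (\<lambda>y z. s (lam x) (f y z)) w) h"
    by (simp add: comult_sum_linear[OF sc])
  also have "\<dots> = comult_sum (\<lambda>w z. comult_sum (\<lambda>x y. s (lam x) (f y z)) w) h"
    by (rule comult_sum_coassoc[OF tri, symmetric])
  also have "\<dots> = comult_sum (\<lambda>x y. f (E x) y) h"
    unfolding E_def by (simp add: comult_sum_linear[OF f1] fs)
  finally show ?thesis .
qed


lemma E_one: "E 1 = 1"
  unfolding E_def comult_sum_eqI[OF bilinear_E comult_one] by (simp add: lam_one)

text \<open>By the partial action axiom with \<open>k = 1\<close>, the functional \<open>\<lambda>\<close> is idempotent under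
  convolution: \<open>\<lambda>(h\<^sub>1) \<lambda>(h\<^sub>2) = \<lambda>(h)\<close>.\<close>

lemma lam_E: "lam (E h) = lam h"
proof -
  have "lam (E h) = comult_sum (\<lambda>x y. lam x * lam (y * 1)) h"
    unfolding E_def by (simp add: comult_sum_linear[OF linear_lam] linear_simps)
  then show ?thesis using lam_mult[of h 1] by (simp add: lam_one)
qed

lemma counit_E: "counit (E h) = lam h"
proof -
  have "counit (E h) = comult_sum (\<lambda>x y. counit (scale (lam x) y)) h"
    unfolding E_def by (rule comult_sum_linear[OF counit_linear])
  also have "\<dots> = comult_sum (\<lambda>x y. lam (scale (counit y) x)) h"
    by (simp only: linear_simps mult.commute)
  also have "\<dots> = lam (comult_sum (\<lambda>x y. scale (counit y) x) h)"
    by (rule comult_sum_linear[OF linear_lam, symmetric])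
  also have "\<dots> = lam h"
    using counit_right[of h] by (simp add: comult_sum_def)
  finally show ?thesis .
qed

lemma lam_E_mult: "lam (E h * k) = lam h * lam k"
proof -
  have "Vector_Spaces.linear scale (*) (\<lambda>x. lam (x * k))"
    by (rule linearI) (simp_all add: vector_space_field linear_simps distrib_right scale_mult_left)
  from comult_sum_linear[OF this] show ?thesis
    unfolding E_def lam_mult[of h k] by (simp add: scale_mult_left linear_simps)
qed

text \<open>The product \<open>E h \<cdot> E k = \<lambda>(h\<^sub>1) \<lambda>(k\<^sub>1) h\<^sub>2 k\<^sub>2\<close> carries the factor
  \<open>\<lambda>(h\<^sub>1) \<lambda>(k\<^sub>1) = \<lambda>(E h\<^sub>1 \<cdot> k\<^sub>1)\<close>, and \<open>E h\<^sub>1 \<otimes> h\<^sub>2\<close> is the coproduct of \<open>E h\<close>. Apart from closing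
  the range of \<open>E\<close> under products, this is the left linearity of \<open>E\<close> over its range that the
  antipode needs.\<close>

lemma E_mult: "E (E h * k) = E h * E k"
proof -
  have lin1: "Vector_Spaces.linear scale scale (\<lambda>x. a * x)" for a
    by (rule linearI) (simp_all add: vector_space_axioms distrib_left scale_mult_right)
  have lin2: "Vector_Spaces.linear scale scale (\<lambda>x. x * b)" for b
    by (rule linearI) (simp_all add: vector_space_axioms distrib_right scale_mult_left)
  have bil: "bilinear scale (\<lambda>x1 x2. comult_sum (\<lambda>y1 y2. scale (lam (x1 * y1)) (x2 * y2)) k)"
    unfolding bilinear_def
    by (intro conjI allI linear_comult_sum_param vector_space_axioms linearI)
      (simp_all add: linear_simps distrib_right scale_mult_left scale_left_distrib
        scale_right_distrib mult.commute)
  have "E (E h * k) = comult_sum (\<lambda>x1 x2.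
      comult_sum (\<lambda>y1 y2. scale (lam (x1 * y1)) (x2 * y2)) k) (E h)"
    using comult_sum_mult[OF bilinear_E, of "E h" k] by (simp only: E_def)
  also have "\<dots> = comult_sum (\<lambda>x1 x2. comult_sum (\<lambda>y1 y2. scale (lam x1) x2 * scale (lam y1) y2) k) h"
    by (simp add: comult_sum_E[OF bil] lam_E_mult scale_mult_left scale_mult_right mult.commute)
  also have "\<dots> = comult_sum (\<lambda>x1 x2. scale (lam x1) x2 * E k) h"
    by (simp only: E_def comult_sum_linear[OF lin1])
  also have "\<dots> = E h * E k"
    unfolding E_def[THEN fun_cong, of h] by (simp only: comult_sum_linear[OF lin2])
  finally show ?thesis .
qed

lemma E_linear_simps: "E (x + y) = E x + E y" "E (scale c x) = scale c (E x)"
  using linear_E by (simp_all add: Vector_Spaces.linear_iff)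

section \<open>The criterion\<close>

text \<open>The right-hand side is \<open>a\<^sub>1 \<lambda>(a\<^sub>2)\<close> for \<open>a = E h\<close>, by \<open>comult_sum_E\<close>: the mirror image
  \<open>a \<mapsto> a\<^sub>1 \<lambda>(a\<^sub>2)\<close> of \<open>E\<close> fixes the range of \<open>E\<close>. It is also \<open>\<lambda>(h\<^sub>1) h\<^sub>2 \<lambda>(h\<^sub>3)\<close>.\<close>

definition right_fixed :: bool where
  "right_fixed \<longleftrightarrow> (\<forall>h. E h = comult_sum (\<lambda>x y. scale (lam y) (E x)) h)"

text \<open>On the range of \<open>E\<close> the functionals \<open>\<lambda>\<close> and \<open>\<epsilon>\<close> agree, so when the coproduct of \<open>a = E h\<close>
  has its second factors there, \<open>a\<^sub>1 \<lambda>(a\<^sub>2) = a\<^sub>1 \<epsilon>(a\<^sub>2) = a\<close>.\<close>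

lemma right_fixed_if_comult_closed:
  assumes "comult ` range E \<subseteq> {tensor2 scale ps | ps. set ps \<subseteq> range E \<times> range E}"
  shows right_fixed
  unfolding right_fixed_def
proof
  fix h
  obtain ps where ps: "comult (E h) = tensor2 scale ps" "set ps \<subseteq> range E \<times> range E"
    using assms by blast
  have bil: "bilinear scale (\<lambda>x y. scale (lam y) x)" "bilinear scale (\<lambda>x y. scale (counit y) x)"
    unfolding bilinear_def by (auto intro!: linearI vector_space_axioms
      simp: linear_simps scale_left_distrib scale_right_distrib mult.commute)
  have "comult_sum (\<lambda>x y. scale (lam y) (E x)) h = comult_sum (\<lambda>x y. scale (lam y) x) (E h)"
    by (simp add: comult_sum_E[OF bil(1)])
  also have "\<dots> = (\<Sum>(x, y)\<leftarrow>ps. scale (lam y) x)"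
    by (rule comult_sum_eqI[OF bil(1) ps(1)])
  also have "\<dots> = (\<Sum>(x, y)\<leftarrow>ps. scale (counit y) x)"
    using ps(2) by (intro arg_cong[where f = sum_list] map_cong) (auto simp: lam_E counit_E)
  also have "\<dots> = E h"
    using comult_sum_eqI[OF bil(2) ps(1)] counit_right[of "E h"] by (simp add: comult_sum_def)
  finally show "E h = comult_sum (\<lambda>x y. scale (lam y) (E x)) h" ..
qed

text \<open>Here \<open>E h\<^sub>1 \<otimes> h\<^sub>2 = E h\<^sub>1 \<lambda>(h\<^sub>2) \<otimes> h\<^sub>3 = E h\<^sub>1 \<otimes> E h\<^sub>2\<close>: the first step is the condition
  applied to \<open>h\<^sub>1\<close>, the second the other bracketing.\<close>

lemma comult_sum_E_E:
  assumes fixed: right_fixed and f: "bilinear s f"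
  shows "comult_sum f (E h) = comult_sum (\<lambda>x y. f (E x) (E y)) h"
proof -
  have s: "vector_space s" using f by (auto simp: bilinear_def Vector_Spaces.linear_iff)
  interpret s: vector_space s by (rule s)
  have f1: "Vector_Spaces.linear scale s (\<lambda>x. f x y)" for y
    using f by (simp add: bilinear_def)
  have f2: "Vector_Spaces.linear scale s (f x)" for x
    using f by (simp add: bilinear_def)
  note fs = Vector_Spaces.linear_iff[THEN iffD1, OF f1] Vector_Spaces.linear_iff[THEN iffD1, OF f2]
  have tri: "trilinear s (\<lambda>x y z. s (lam y) (f (E x) z))"
    unfolding trilinear_def
    by (auto intro!: linearI s simp: linear_simps E_linear_simps fs s.scale_left_distrib
      s.scale_right_distrib mult.commute)
  have right: "f (E w) z = comult_sum (\<lambda>x y. s (lam y) (f (E x) z)) w" for w z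
  proof -
    have "E w = comult_sum (\<lambda>x y. scale (lam y) (E x)) w"
      using fixed unfolding right_fixed_def by blast
    then have "f (E w) z = f (comult_sum (\<lambda>x y. scale (lam y) (E x)) w) z"
      by (rule arg_cong[where f = "\<lambda>v. f v z"])
    then show ?thesis by (simp add: comult_sum_linear[OF f1] fs)
  qed
  have left: "comult_sum (\<lambda>y z. s (lam y) (f v z)) w = f v (E w)" for v w
    unfolding E_def by (simp add: comult_sum_linear[OF f2] fs)
  have "comult_sum f (E h) = comult_sum (\<lambda>w z. f (E w) z) h"
    by (rule comult_sum_E[OF f])
  also have "\<dots> = comult_sum (\<lambda>w z. comult_sum (\<lambda>x y. s (lam y) (f (E x) z)) w) h"
    by (intro arg_cong2[where f = comult_sum] ext right refl)
  also have "\<dots> = comult_sum (\<lambda>x w. comult_sum (\<lambda>y z. s (lam y) (f (E x) z)) w) h"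
    by (rule comult_sum_coassoc[OF tri])
  also have "\<dots> = comult_sum (\<lambda>x w. f (E x) (E w)) h"
    by (simp only: left)
  finally show ?thesis .
qed

lemma comult_E:
  assumes right_fixed
  shows "comult (E h) = tensor2 scale (map (\<lambda>(x, y). (E x, E y)) (sweedler scale comult h))"
proof (rule comult_eqI)
  fix f :: "'a \<Rightarrow> 'a \<Rightarrow> ('a \<times> 'a \<Rightarrow>\<^sub>0 'k)"
  assume "bilinear free_scale f"
  from comult_sum_E_E[OF assms this]
  show "comult_sum f (E h) =
      (\<Sum>(x, y)\<leftarrow>map (\<lambda>(x, y). (E x, E y)) (sweedler scale comult h). f x y)"
    by (simp add: comult_sum_def o_def case_prod_unfold)
qed

text \<open>Uniqueness of convolution inverses, with \<open>a = E h\<close>: as \<open>\<Delta>(a)\<close> has its second factors in the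
  range of \<open>E\<close>, where \<open>b\<^sub>1 E(S b\<^sub>2) = \<epsilon>(b) 1\<close>, one has
  \<open>S a = S(a\<^sub>1) \<epsilon>(a\<^sub>2) = S(a\<^sub>1) a\<^sub>2 E(S a\<^sub>3) = \<epsilon>(a\<^sub>1) E(S a\<^sub>2) = E(S a)\<close>.\<close>

lemma antipode_E:
  assumes fixed: right_fixed
  shows "antipode (E h) = E (antipode (E h))"
proof -
  note lin_simps = linear_simps E_linear_simps distrib_left distrib_right scale_mult_left
    scale_mult_right scale_left_distrib scale_right_distrib mult.commute
  have antipode_lr: "comult_sum (\<lambda>x y. antipode x * y) w = scale (counit w) 1"
    "comult_sum (\<lambda>x y. x * antipode y) w = scale (counit w) 1" for w
    using antipode_left antipode_right by (simp_all add: comult_sum_def)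
  have counit_lr: "comult_sum (\<lambda>x y. scale (counit x) y) w = w"
    "comult_sum (\<lambda>x y. scale (counit y) x) w = w" for w
    using counit_left counit_right by (simp_all add: comult_sum_def)
  have lin_left: "Vector_Spaces.linear scale scale (\<lambda>x. b * x)" for b
    by (rule linearI) (simp_all add: vector_space_axioms lin_simps)
  have lin_right: "Vector_Spaces.linear scale scale (\<lambda>x. x * b)" for b
    by (rule linearI) (simp_all add: vector_space_axioms lin_simps)
  have bil: "bilinear scale (\<lambda>x y. x * E (antipode y))" "bilinear scale (\<lambda>x y. x * antipode y)"
    "bilinear scale (\<lambda>x y. scale (counit y) (antipode x))"
    unfolding bilinear_def by (auto intro!: linearI vector_space_axioms simp: lin_simps)
  \<comment> \<open>Left linearity of \<open>E\<close> over its range moves the product into the argument of \<open>E\<close>, where the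
    antipode axiom applies.\<close>
  have conv: "comult_sum (\<lambda>x y. x * E (antipode y)) (E k) = scale (counit (E k)) 1" for k
  proof -
    have "comult_sum (\<lambda>x y. x * E (antipode y)) (E k)
        = E (comult_sum (\<lambda>x y. E x * antipode y) k)"
      by (simp add: comult_sum_E[OF bil(1)] comult_sum_linear[OF linear_E] E_mult)
    also have "\<dots> = E (comult_sum (\<lambda>x y. x * antipode y) (E k))"
      by (simp add: comult_sum_E[OF bil(2)])
    also have "\<dots> = scale (counit (E k)) 1"
      by (simp add: antipode_lr E_linear_simps E_one)
    finally show ?thesis .
  qed
  have bil_conv: "bilinear scale (\<lambda>x w. antipode x * comult_sum (\<lambda>u v. u * E (antipode v)) w)"
    using linear_comult_sum[OF bil(1), THEN Vector_Spaces.linear_iff[THEN iffD1]]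
    unfolding bilinear_def by (auto intro!: linearI vector_space_axioms simp: lin_simps)
  have tri: "trilinear scale (\<lambda>x y z. antipode x * (y * E (antipode z)))"
    unfolding trilinear_def by (auto intro!: linearI vector_space_axioms simp: lin_simps)
  let ?a = "E h"
  have "antipode ?a = antipode (comult_sum (\<lambda>x y. scale (counit y) x) ?a)"
    by (simp only: counit_lr)
  also have "\<dots> = comult_sum (\<lambda>x y. scale (counit y) (antipode x)) ?a"
    by (simp add: comult_sum_linear[OF antipode_linear] linear_simps)
  also have "\<dots> = comult_sum (\<lambda>x w. antipode x * comult_sum (\<lambda>u v. u * E (antipode v)) w) ?a"
    \<comment> \<open>\<open>conv\<close> holds on the range of \<open>E\<close> only, so both sides are first summed over
      \<open>E h\<^sub>1 \<otimes> E h\<^sub>2\<close>.\<close>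
    unfolding comult_sum_E_E[OF fixed bil(3)] comult_sum_E_E[OF fixed bil_conv]
    by (simp add: conv scale_mult_right)
  also have "\<dots> = comult_sum (\<lambda>x w. comult_sum (\<lambda>y z. antipode x * (y * E (antipode z))) w) ?a"
    by (simp add: comult_sum_linear[OF lin_left])
  also have "\<dots> = comult_sum (\<lambda>w z. comult_sum (\<lambda>x y. antipode x * (y * E (antipode z))) w) ?a"
    by (rule comult_sum_coassoc[OF tri, symmetric])
  also have "\<dots> = comult_sum (\<lambda>w z. comult_sum (\<lambda>x y. antipode x * y) w * E (antipode z)) ?a"
    by (simp add: comult_sum_linear[OF lin_right] mult.assoc)
  also have "\<dots> = comult_sum (\<lambda>w z. E (antipode (scale (counit w) z))) ?a"
    by (simp add: antipode_lr scale_mult_left linear_simps E_linear_simps)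
  also have "\<dots> = E (antipode (comult_sum (\<lambda>w z. scale (counit w) z) ?a))"
    by (simp add: comult_sum_linear[OF linear_E] comult_sum_linear[OF antipode_linear])
  also have "\<dots> = E (antipode ?a)"
    by (simp only: counit_lr)
  finally show ?thesis .
qed

lemma hopf_subalgebra_iff: "hopf_subalgebra scale comult antipode (range E) \<longleftrightarrow> right_fixed"
proof
  assume "hopf_subalgebra scale comult antipode (range E)"
  then show right_fixed
    unfolding hopf_subalgebra_def by (elim conjE) (rule right_fixed_if_comult_closed)
next
  assume fixed: right_fixed
  interpret E: Vector_Spaces.linear scale scale E by (rule linear_E)
  have "subspace (range E)"
    by (rule E.subspace_image[OF subspace_UNIV])
  moreover have "1 \<in> range E"
    by (rule range_eqI[of _ _ 1]) (simp add: E_one)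
  moreover have "\<forall>x\<in>range E. \<forall>y\<in>range E. x * y \<in> range E"
    by (auto simp flip: E_mult)
  moreover have "comult ` range E \<subseteq> {tensor2 scale ps | ps. set ps \<subseteq> range E \<times> range E}"
  proof (intro image_subsetI)
    fix a assume "a \<in> range E"
    then obtain h where a: "a = E h" by blast
    have "set (map (\<lambda>(x, y). (E x, E y)) (sweedler scale comult h)) \<subseteq> range E \<times> range E"
      by auto
    then show "comult a \<in> {tensor2 scale ps | ps. set ps \<subseteq> range E \<times> range E}"
      unfolding a comult_E[OF fixed] by blast
  qed
  moreover have "antipode ` range E \<subseteq> range E"
  proof (intro image_subsetI)
    fix a assume "a \<in> range E"
    then obtain h where a: "a = E h" by blast
    show "antipode a \<in> range E"
      unfolding a by (subst antipode_E[OF fixed]) (rule rangeI)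
  qed
  ultimately show "hopf_subalgebra scale comult antipode (range E)"
    unfolding hopf_subalgebra_def by (intro conjI)
qed

end

theorem theorem4p6:
  fixes scale :: "'k::field \<Rightarrow> 'a::ring_1 \<Rightarrow> 'a"
    and comult :: "'a \<Rightarrow> ('a \<times> 'a \<Rightarrow>\<^sub>0 'k) set"
    and counit :: "'a \<Rightarrow> 'k"
    and antipode :: "'a \<Rightarrow> 'a"
    and lam :: "'a \<Rightarrow> 'k"
  assumes "hopf_algebra scale comult counit antipode"
    and "\<exists>B. finite_dimensional_vector_space scale B"
    and "partial_action scale comult lam"
  shows "hopf_subalgebra scale comult antipode (H_lam scale comult lam) \<longleftrightarrow>
    (\<forall>h. (\<Sum>(h1, h2)\<leftarrow>sweedler scale comult h. scale (lam h1) h2) =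
         (\<Sum>(h1, h2, h3)\<leftarrow>sweedler3 scale comult h. scale (lam h3) (scale (lam h1) h2)))"
proof -
  interpret hopf_algebra scale comult counit antipode by (rule assms(1))
  interpret partial_action_on_field scale comult counit antipode lam
    by unfold_locales (rule assms(3))
  have E: "(\<Sum>(h1, h2)\<leftarrow>sweedler scale comult h. scale (lam h1) h2) = E h" for h
    by (simp add: E_def comult_sum_def)
  have scale_E: "comult_sum (\<lambda>x y. scale c (scale (lam x) y)) w = scale c (E w)" for c w
    unfolding E_def by (rule comult_sum_linear[OF linear_scale_self, symmetric])
  have "H_lam scale comult lam = range E"
    by (auto simp: H_lam_def E)
  then show ?thesis
    by (simp only: hopf_subalgebra_iff right_fixed_def E sum_sweedler3 scale_E)
qed

end
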